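(* Let $M\in\mathbb{R}^{m\times n}$, let $P_B\in\mathbb{R}^{m\times m}$ and $P_A\in\mathbb{R}^{n\times n}$ be symmetric positive definite, and put $C=P_BMP_A$ and $q_P(D)=\|P_B^{-1}DP_A^{-1}\|_{\mathrm{op}}$ for $D\in\mathbb{R}^{m\times n}$. Let $\rho\ge 0$, and let $Q(C)\in\mathbb{R}^{m\times n}$ be any matrix satisfying $$Q(C)\in\arg\max_{\|U\|_{\mathrm{op}}\le 1}\langle C,U\rangle .$$ Then the value of the problem $$\max_{D\in\mathbb{R}^{m\times n}}\ \langle M,D\rangle\quad\text{subject to}\quad q_P(D)\le\rho$$ is $\rho\|C\|_*$, and one maximizer is $$D_\rho=\rho\,P_BQ(C)P_A .$$ At unit radius, writing $D_0:=D_1=P_BQ(C)P_A$, $$\langle M,D_0\rangle=\langle C,Q(C)\rangle=\|C\|_* ,$$ and this quantity is strictly positive if $M\neq 0$. Moreover, $-D_\rho$ is a minimizer of $\langle M,D\rangle$ over $\{D: q_P(D)\le\rho\}$.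
   Context: $\langle X,Y\rangle=\operatorname{tr}(X^\top Y)$ is the Frobenius inner product, $\|\cdot\|_{\mathrm{op}}$ is the spectral (operator) norm and $\|\cdot\|_*$ is the nuclear norm (sum of singular values). *)

theory Defs
  imports "HOL-Analysis.Analysis"
begin

text \<open>An m by n real matrix has type \<^typ>\<open>real^'n^'m\<close>.\<close>

definition frobenius_inner :: "real^'n^'m \<Rightarrow> real^'n^'m \<Rightarrow> real" where
  "frobenius_inner X Y = trace (transpose X ** Y)"

definition op_norm :: "real^'n^'m \<Rightarrow> real" where
  "op_norm X = onorm ((*v) X)"

definition sym_pos_def :: "real^'n^'n \<Rightarrow> bool" where
  "sym_pos_def P \<longleftrightarrow> transpose P = P \<and> (\<forall>x. x \<noteq> 0 \<longrightarrow> 0 < x \<bullet> (P *v x))"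

definition eigenspace :: "real^'n^'n \<Rightarrow> real \<Rightarrow> (real^'n) set" where
  "eigenspace S t = {v. S *v v = t *\<^sub>R v}"

text \<open>The singular values of X are the nonnegative square roots of the eigenvalues of
  \<open>transpose X ** X\<close>. The multiplicity is the dimension of the eigenspace, which for a symmetric
  matrix is also the multiplicity of the root of the characteristic polynomial. If X has more
  columns than rows, then the multiplicity of the singular value 0 differs from the one in the
  convention with min m n singular values; this does not affect their sum.\<close>

definition singular_values :: "real^'n^'m \<Rightarrow> real set" where
  "singular_values X =
     {s. 0 \<le> s \<and> (\<exists>v. v \<noteq> 0 \<and> v \<in> eigenspace (transpose X ** X) (s\<^sup>2))}"

definition sv_multiplicity :: "real^'n^'m \<Rightarrow> real \<Rightarrow> nat" where
  "sv_multiplicity X s = dim (eigenspace (transpose X ** X) (s\<^sup>2))"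

definition nuclear_norm :: "real^'n^'m \<Rightarrow> real" where
  "nuclear_norm X = (\<Sum>s\<in>singular_values X. real (sv_multiplicity X s) * s)"

text \<open>The index set of the sum above is finite, so the sum is not the default value 0.\<close>

lemma finite_singular_values: "finite (singular_values X)"
proof -
  define S where "S = transpose X ** X"
  have sym: "u \<bullet> (S *v w) = (S *v u) \<bullet> w" for u w
    by (metis S_def dot_lmul_matrix matrix_transpose_mul transpose_matrix_vector transpose_transpose)
  have "\<forall>s\<in>singular_values X. \<exists>v. v \<noteq> 0 \<and> S *v v = s\<^sup>2 *\<^sub>R v"
    by (auto simp: singular_values_def eigenspace_def S_def)
  then obtain v where v: "\<And>s. s \<in> singular_values X \<Longrightarrow> v s \<noteq> 0 \<and> S *v v s = s\<^sup>2 *\<^sub>R v s"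
    by (metis bchoice)
  have orth: "v s \<bullet> v t = 0"
    if s: "s \<in> singular_values X" and t: "t \<in> singular_values X" and "s \<noteq> t" for s t
  proof -
    have "s\<^sup>2 * (v s \<bullet> v t) = t\<^sup>2 * (v s \<bullet> v t)"
      using sym [of "v s" "v t"] v [OF s] v [OF t] by auto
    moreover have "s\<^sup>2 \<noteq> t\<^sup>2"
      using that by (auto simp: singular_values_def power2_eq_iff_nonneg)
    ultimately show ?thesis by simp
  qed
  have inj: "inj_on v (singular_values X)"
    using orth v by (metis inj_onI inner_eq_zero_iff)
  have "pairwise orthogonal (v ` singular_values X)"
    using orth by (auto simp: pairwise_def orthogonal_def)
  moreover have "0 \<notin> v ` singular_values X"
    using v by auto
  ultimately have "finite (v ` singular_values X)"
    by (intro finiteI_independent pairwise_orthogonal_independent)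
  then show ?thesis using inj by (rule finite_imageD)
qed

definition precond_norm :: "real^'m^'m \<Rightarrow> real^'n^'n \<Rightarrow> real^'n^'m \<Rightarrow> real" where
  "precond_norm PB PA D = op_norm (matrix_inv PB ** D ** matrix_inv PA)"

end

theory Submission
  imports Defs
begin

text \<open>The substitution \<open>X = PB ** U ** PA\<close> is a bijection that turns the constraint into
  \<open>op_norm U \<le> \<rho>\<close> and the objective into \<open>frobenius_inner C U\<close>, so everything reduces to the
  duality of the operator norm and the nuclear norm. For that, let B be an orthonormal basis of
  eigenvectors of \<open>transpose C ** C\<close>. The nuclear norm of C is the sum of \<open>norm (C *v b)\<close> over B, and
  \<open>frobenius_inner C U\<close> is the sum of \<open>(C *v b) \<bullet> (U *v b)\<close>, so Cauchy-Schwarz gives the upper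
  bound and the partial isometry in the polar decomposition of C attains it.\<close>

subsection \<open>Diagonalization of self-adjoint maps\<close>

text \<open>First-order optimality of the Rayleigh quotient. Invariance of \<open>V\<close> keeps
  the residual \<open>w\<close> in \<open>V\<close>, so \<open>w\<close> is an admissible direction
  of variation.\<close>

lemma self_adjoint_rayleigh_maximizer_eigen:
  fixes f :: "'a::euclidean_space \<Rightarrow> 'a"
  assumes f: "linear f"
    and self: "\<And>x y. x \<bullet> f y = f x \<bullet> y"
    and V: "subspace V" and inv: "f ` V \<subseteq> V"
    and v: "v \<in> V" "norm v = 1"
    and max: "\<And>x. x \<in> V \<Longrightarrow> norm x = 1 \<Longrightarrow> x \<bullet> f x \<le> v \<bullet> f v"
  shows "f v = (v \<bullet> f v) *\<^sub>R v"
proof -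
  define l where "l = v \<bullet> f v"
  define w where "w = l *\<^sub>R v - f v"
  \<comment> \<open>Both sides are homogeneous of degree 2, so the bound on unit vectors extends to
    all of \<open>V\<close>.\<close>
  have bound: "x \<bullet> f x \<le> l * (x \<bullet> x)" if "x \<in> V" for x
  proof (cases "x = 0")
    case True
    then show ?thesis by simp
  next
    case False
    have "sgn x \<in> V"
      by (simp add: sgn_div_norm V subspace_scale that)
    then have "sgn x \<bullet> f (sgn x) \<le> l"
      using max [of "sgn x"] False by (simp add: norm_sgn l_def)
    then have "(x \<bullet> f x) / (norm x)\<^sup>2 \<le> l"
      by (simp add: sgn_div_norm linear_cmul [OF f] divide_simps power2_eq_square)
    then show ?thesis
      using False by (simp add: divide_simps power2_norm_eq_inner)
  qed
  have vv: "v \<bullet> v = 1"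
    using v by (simp add: norm_eq_1)
  have wV: "w \<in> V"
    using V v inv by (auto simp: w_def intro!: subspace_diff subspace_scale)
  define g where "g = l * (w \<bullet> w) - w \<bullet> f w"
  \<comment> \<open>The form \<open>l * (x \<bullet> x) - x \<bullet> f x\<close> is nonnegative on V and vanishes at v, hence so does
    its derivative at v in direction w, which is \<open>2 * (w \<bullet> w)\<close>.\<close>
  have quad: "0 \<le> 2 * t * (w \<bullet> w) + t\<^sup>2 * g" for t
  proof -
    have "v + t *\<^sub>R w \<in> V"
      using V v wV by (auto intro!: subspace_add subspace_scale)
    then have le: "(v + t *\<^sub>R w) \<bullet> f (v + t *\<^sub>R w) \<le> l * ((v + t *\<^sub>R w) \<bullet> (v + t *\<^sub>R w))"
      by (rule bound)
    have lhs: "(v + t *\<^sub>R w) \<bullet> f (v + t *\<^sub>R w) = l + 2 * t * (f v \<bullet> w) + t\<^sup>2 * (w \<bullet> f w)"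
      using self [of v w]
      by (simp add: linear_add [OF f] linear_cmul [OF f] inner_add_left inner_add_right
          l_def power2_eq_square inner_commute algebra_simps)
    have rhs: "(v + t *\<^sub>R w) \<bullet> (v + t *\<^sub>R w) = 1 + 2 * t * (v \<bullet> w) + t\<^sup>2 * (w \<bullet> w)"
      using vv
      by (simp add: inner_add_left inner_add_right power2_eq_square inner_commute algebra_simps)
    have "0 \<le> 2 * t * (l * (v \<bullet> w) - f v \<bullet> w) + t\<^sup>2 * g"
      using le unfolding lhs rhs g_def by (simp add: algebra_simps)
    moreover have "l * (v \<bullet> w) - f v \<bullet> w = w \<bullet> w"
      by (subst (3) w_def) (simp add: inner_diff_left)
    ultimately show ?thesis
      by simp
  qed
  have "w \<bullet> w = 0"
  proof (rule ccontr)
    assume "w \<bullet> w \<noteq> 0"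
    then have pos: "0 < w \<bullet> w" by simp
    \<comment> \<open>A negative step makes the linear term of \<open>quad\<close> negative, and
      this size keeps \<open>\<bar>t * g\<bar>\<close> at most \<open>w \<bullet> w\<close>, so the
      quadratic term cannot compensate. The summand 1 avoids division by zero.\<close>
    define t where "t = - (w \<bullet> w) / (\<bar>g\<bar> + 1)"
    have t: "t < 0"
      using pos by (simp add: t_def divide_neg_pos)
    have "- t * \<bar>g\<bar> \<le> w \<bullet> w"
      using pos by (simp add: t_def field_simps)
    moreover have "- t * g \<le> - t * \<bar>g\<bar>"
      using t by (intro mult_left_mono) auto
    ultimately have "0 < 2 * (w \<bullet> w) + t * g"
      using pos by linarith
    then have "t * (2 * (w \<bullet> w) + t * g) < 0"
      using t by (simp add: mult_neg_pos)
    with quad [of t] show False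
      by (simp add: power2_eq_square algebra_simps)
  qed
  then show ?thesis
    by (simp add: w_def l_def)
qed

text \<open>Spectral theorem by induction on dimension: a maximizer of
  \<open>x \<bullet> f x\<close> on the compact unit sphere of \<open>V\<close> is an eigenvector,
  and the induction continues on its orthogonal complement in \<open>V\<close>. Invariant subspaces
  appear in the statement because these complements are not the whole space.\<close>

lemma self_adjoint_orthonormal_eigenbasis_subspace:
  fixes f :: "'a::euclidean_space \<Rightarrow> 'a"
  assumes f: "linear f"
    and self: "\<And>x y. x \<bullet> f y = f x \<bullet> y"
    and "subspace V" and "f ` V \<subseteq> V"
  shows "\<exists>B. finite B \<and> pairwise orthogonal B \<and> (\<forall>b\<in>B. norm b = 1) \<and> span B = V \<and>
    (\<forall>b\<in>B. f b = (b \<bullet> f b) *\<^sub>R b)"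
  using assms(3,4)
proof (induction "dim V" arbitrary: V rule: less_induct)
  case less
  show ?case
  proof (cases "V = {0}")
    case True
    then show ?thesis
      by (intro exI [of _ "{}"]) auto
  next
    case False
    then obtain u where u: "u \<in> V" "u \<noteq> 0"
      using less.prems subspace_0 by blast
    have "sgn u \<in> sphere 0 1 \<inter> V"
      using u less.prems by (simp add: norm_sgn sgn_div_norm subspace_scale)
    then have ne: "sphere 0 1 \<inter> V \<noteq> {}" by blast
    have "compact (sphere 0 1 \<inter> V)"
      using less.prems by (intro compact_Int_closed closed_subspace) auto
    moreover have "continuous_on (sphere 0 1 \<inter> V) (\<lambda>x. x \<bullet> f x)"
      using f by (intro continuous_intros linear_continuous_on) (simp add: linear_conv_bounded_linear)
    ultimately obtain v where "v \<in> sphere 0 1 \<inter> V"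
      and sup: "\<forall>x\<in>sphere 0 1 \<inter> V. x \<bullet> f x \<le> v \<bullet> f v"
      using continuous_attains_sup [OF _ ne] by blast
    then have v: "v \<in> V" "norm v = 1" by auto
    have max: "x \<bullet> f x \<le> v \<bullet> f v" if "x \<in> V" "norm x = 1" for x
      using sup that by auto
    have fv: "f v = (v \<bullet> f v) *\<^sub>R v"
      by (rule self_adjoint_rayleigh_maximizer_eigen [OF f self less.prems v max])
    define W where "W = V \<inter> {x. v \<bullet> x = 0}"
    have W: "subspace W"
      unfolding W_def using less.prems by (intro subspace_inter subspace_hyperplane)
    \<comment> \<open>Self-adjointness moves \<open>f\<close> onto the eigenvector \<open>v\<close>,
      so orthogonality to \<open>v\<close> is preserved.\<close>
    have "f ` W \<subseteq> W"
    proof -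
      have "v \<bullet> f x = 0" if "v \<bullet> x = 0" for x
        using self [of v x] that by (subst (asm) fv) simp
      then show ?thesis
        using less.prems by (auto simp: W_def)
    qed
    have "v \<notin> W"
      using v by (simp add: W_def norm_eq_1)
    moreover have "W \<subseteq> V"
      by (simp add: W_def)
    ultimately have "W \<subset> V"
      using v by blast
    then have "dim W < dim V"
      using W less.prems by (metis dim_psubset span_eq_iff)
    from less.hyps [OF this W \<open>f ` W \<subseteq> W\<close>] obtain B
      where B: "finite B" "pairwise orthogonal B" "\<forall>b\<in>B. norm b = 1" "span B = W"
        "\<forall>b\<in>B. f b = (b \<bullet> f b) *\<^sub>R b"
      by blast
    have BW: "B \<subseteq> W"
      using B(4) span_superset by blast
    have "span (insert v B) = V"
    proof
      show "span (insert v B) \<subseteq> V"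
        using BW v less.prems by (intro span_minimal) (auto simp: W_def)
      show "V \<subseteq> span (insert v B)"
      proof
        fix x assume "x \<in> V"
        then have "x - (v \<bullet> x) *\<^sub>R v \<in> W"
          using v less.prems
          by (auto simp: W_def inner_diff_right norm_eq_1 intro!: subspace_diff subspace_scale)
        then show "x \<in> span (insert v B)"
          using B(4) span_breakdown_eq by blast
      qed
    qed
    moreover have "pairwise orthogonal (insert v B)"
      using B(2) BW by (auto simp: pairwise_insert W_def orthogonal_def inner_commute)
    ultimately show ?thesis
      using B v fv by (intro exI [of _ "insert v B"]) auto
  qed
qed

lemma self_adjoint_orthonormal_eigenbasis:
  fixes f :: "'a::euclidean_space \<Rightarrow> 'a"
  assumes "linear f" and "\<And>x y. x \<bullet> f y = f x \<bullet> y"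
  obtains B where "finite B" "pairwise orthogonal B" "\<And>b. b \<in> B \<Longrightarrow> norm b = 1" "span B = UNIV"
    "\<And>b. b \<in> B \<Longrightarrow> f b = (b \<bullet> f b) *\<^sub>R b"
  using self_adjoint_orthonormal_eigenbasis_subspace [OF assms subspace_UNIV subset_UNIV] by blast

lemma inner_orthonormal_basis:
  fixes x y :: "'a::euclidean_space"
  assumes "finite B" "pairwise orthogonal B" "\<And>b. b \<in> B \<Longrightarrow> norm b = 1" "span B = UNIV"
  shows "x \<bullet> y = (\<Sum>b\<in>B. (x \<bullet> b) * (y \<bullet> b))"
proof -
  have "y = (\<Sum>b\<in>B. (y \<bullet> b) *\<^sub>R b)"
    using orthonormal_basis_expand [of B y] assms by simp
  then have "x \<bullet> y = x \<bullet> (\<Sum>b\<in>B. (y \<bullet> b) *\<^sub>R b)"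
    by simp
  then show ?thesis
    by (simp add: inner_sum_right mult.commute)
qed

lemma orthonormal_independent:
  fixes B :: "'a::euclidean_space set"
  assumes "pairwise orthogonal B" "\<And>b. b \<in> B \<Longrightarrow> norm b = 1"
  shows "independent B"
proof (rule pairwise_orthogonal_independent)
  show "0 \<notin> B"
    using assms(2) [of 0] by auto
qed (rule assms(1))

subsection \<open>Frobenius inner product and operator norm\<close>

lemma frobenius_inner_eq_inner: "frobenius_inner X Y = X \<bullet> Y"
proof -
  have "frobenius_inner X Y = (\<Sum>j\<in>UNIV. \<Sum>i\<in>UNIV. X $ i $ j * Y $ i $ j)"
    by (simp add: frobenius_inner_def trace_def matrix_matrix_mult_def transpose_def)
  also have "\<dots> = (\<Sum>i\<in>UNIV. \<Sum>j\<in>UNIV. X $ i $ j * Y $ i $ j)"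
    by (rule sum.swap)
  finally show ?thesis
    by (simp add: inner_vec_def)
qed

text \<open>The trace can be computed in any orthonormal basis; here this is Parseval's identity
  applied to each pair of rows.\<close>

lemma frobenius_inner_orthonormal_basis:
  fixes X Y :: "real^'n^'m"
  assumes "finite B" "pairwise orthogonal B" "\<And>b. b \<in> B \<Longrightarrow> norm b = 1" "span B = UNIV"
  shows "frobenius_inner X Y = (\<Sum>b\<in>B. (X *v b) \<bullet> (Y *v b))"
proof -
  have "frobenius_inner X Y = (\<Sum>i\<in>UNIV. X $ i \<bullet> Y $ i)"
    by (simp add: frobenius_inner_eq_inner inner_vec_def [of X])
  also have "\<dots> = (\<Sum>i\<in>UNIV. \<Sum>b\<in>B. (X $ i \<bullet> b) * (Y $ i \<bullet> b))"
    using inner_orthonormal_basis [OF assms] by metis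
  also have "\<dots> = (\<Sum>b\<in>B. \<Sum>i\<in>UNIV. (X $ i \<bullet> b) * (Y $ i \<bullet> b))"
    by (rule sum.swap)
  also have "\<dots> = (\<Sum>b\<in>B. (X *v b) \<bullet> (Y *v b))"
    by (simp add: inner_vec_def [of "X *v _"] matrix_vector_mul_component)
  finally show ?thesis .
qed

text \<open>Cyclicity of the trace moves the outer factors to the other argument. For symmetric
  preconditioners the transposes disappear, which produces \<open>C\<close>.\<close>

lemma frobenius_inner_mult:
  fixes M U :: "real^'n^'m" and P :: "real^'m^'m" and R :: "real^'n^'n"
  shows "frobenius_inner M (P ** U ** R) = frobenius_inner (transpose P ** M ** transpose R) U"
proof -
  have "trace (transpose M ** (P ** U ** R)) = trace ((transpose M ** P ** U) ** R)"
    by (simp add: matrix_mul_assoc)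
  also have "\<dots> = trace (R ** (transpose M ** P ** U))"
    by (rule trace_mul_sym)
  finally show ?thesis
    by (simp add: frobenius_inner_def matrix_transpose_mul matrix_mul_assoc)
qed

lemma norm_mult_le_op_norm: "norm (X *v x) \<le> op_norm X * norm x"
  unfolding op_norm_def by (rule onorm) simp

lemma op_norm_scaleR: "op_norm (r *\<^sub>R X) = \<bar>r\<bar> * op_norm X"
proof -
  have "(*v) (r *\<^sub>R X) = (\<lambda>x. r *\<^sub>R (X *v x))"
    by (simp add: fun_eq_iff scaleR_matrix_vector_assoc)
  then show ?thesis
    by (simp add: op_norm_def onorm_scaleR)
qed

subsection \<open>The nuclear norm in an eigenbasis of the Gram matrix\<close>

text \<open>These are the right singular vectors of \<open>X\<close>. Writing the eigenvalue as a
  squared norm makes \<open>norm (X *v b)\<close> the singular value belonging to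
  \<open>b\<close>.\<close>

definition right_singular_basis :: "real^'n^'m \<Rightarrow> (real^'n) set \<Rightarrow> bool" where
  "right_singular_basis X B \<longleftrightarrow>
    finite B \<and> pairwise orthogonal B \<and> (\<forall>b\<in>B. norm b = 1) \<and> span B = UNIV \<and>
    (\<forall>b\<in>B. transpose X ** X *v b = (norm (X *v b))\<^sup>2 *\<^sub>R b)"

lemma inner_gram:
  fixes X :: "real^'n^'m"
  shows "x \<bullet> (transpose X ** X *v y) = (X *v x) \<bullet> (X *v y)"
  using dot_lmul_matrix [of "X *v y" X x]
  by (simp add: inner_commute flip: matrix_vector_mul_assoc)

lemma right_singular_basis_exists: "\<exists>B. right_singular_basis X B"
proof -
  let ?f = "(*v) (transpose X ** X)"
  have "x \<bullet> ?f y = ?f x \<bullet> y" for x y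
    by (metis inner_gram inner_commute)
  then obtain B where "finite B" "pairwise orthogonal B" "\<And>b. b \<in> B \<Longrightarrow> norm b = 1"
    "span B = UNIV" "\<And>b. b \<in> B \<Longrightarrow> ?f b = (b \<bullet> ?f b) *\<^sub>R b"
    using self_adjoint_orthonormal_eigenbasis [OF matrix_vector_mul_linear, of "transpose X ** X"]
    by metis
  then show ?thesis
    by (auto simp: right_singular_basis_def inner_gram power2_norm_eq_inner)
qed

text \<open>The basis vectors with singular value \<open>s\<close> span the whole eigenspace,
  because eigenvectors for different eigenvalues are orthogonal.\<close>

lemma sv_multiplicity_eq_card:
  assumes B: "right_singular_basis X B" and "0 \<le> s"
  shows "sv_multiplicity X s = card {b\<in>B. norm (X *v b) = s}"
proof -
  let ?S = "transpose X ** X" and ?B = "{b\<in>B. norm (X *v b) = s}"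
  have fin: "finite B" and orth: "pairwise orthogonal B" and unit: "\<And>b. b \<in> B \<Longrightarrow> norm b = 1"
    and span: "span B = UNIV" and eig: "\<And>b. b \<in> B \<Longrightarrow> ?S *v b = (norm (X *v b))\<^sup>2 *\<^sub>R b"
    using B by (auto simp: right_singular_basis_def)
  have "eigenspace ?S (s\<^sup>2) = span ?B"
  proof
    show "span ?B \<subseteq> eigenspace ?S (s\<^sup>2)"
    proof (rule span_minimal)
      show "?B \<subseteq> eigenspace ?S (s\<^sup>2)"
        using eig by (auto simp: eigenspace_def)
      show "subspace (eigenspace ?S (s\<^sup>2))"
        by (auto simp: subspace_def eigenspace_def matrix_vector_right_distrib
            matrix_vector_mult_scaleR scaleR_right_distrib)
    qed
    show "eigenspace ?S (s\<^sup>2) \<subseteq> span ?B"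
    proof
      fix v assume "v \<in> eigenspace ?S (s\<^sup>2)"
      then have v: "?S *v v = s\<^sup>2 *\<^sub>R v"
        by (simp add: eigenspace_def)
      have zero: "v \<bullet> b = 0" if b: "b \<in> B - ?B" for b
      proof -
        have "v \<bullet> (?S *v b) = (?S *v v) \<bullet> b"
          by (metis inner_gram inner_commute)
        then have "(norm (X *v b))\<^sup>2 * (v \<bullet> b) = s\<^sup>2 * (v \<bullet> b)"
          using b eig v by auto
        \<comment> \<open>Squaring is injective on nonnegative reals; this is where
          \<open>0 \<le> s\<close> enters.\<close>
        moreover have "(norm (X *v b))\<^sup>2 \<noteq> s\<^sup>2"
          using b \<open>0 \<le> s\<close> by (auto)
        ultimately show ?thesis by simp
      qed
      have "v = (\<Sum>b\<in>B. (v \<bullet> b) *\<^sub>R b)"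
        using orthonormal_basis_expand [of B v] fin orth unit span by simp
      also have "\<dots> = (\<Sum>b\<in>?B. (v \<bullet> b) *\<^sub>R b)"
        using fin zero by (intro sum.mono_neutral_right) auto
      also have "\<dots> \<in> span ?B"
        by (intro span_sum span_scale span_base)
      finally show "v \<in> span ?B" .
    qed
  qed
  moreover have "independent ?B"
    using orthonormal_independent [OF orth unit] by (rule independent_mono) auto
  ultimately show ?thesis
    by (simp add: sv_multiplicity_def dim_eq_card_independent)
qed

text \<open>Grouping the basis by singular value turns each multiplicity into a number of equal
  summands.\<close>

lemma nuclear_norm_eq_sum:
  assumes B: "right_singular_basis X B"
  shows "nuclear_norm X = (\<Sum>b\<in>B. norm (X *v b))"
proof -
  have "(\<lambda>b. norm (X *v b)) ` B \<subseteq> singular_values X"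
  proof (rule image_subsetI)
    fix b assume "b \<in> B"
    then have "norm b = 1" "transpose X ** X *v b = (norm (X *v b))\<^sup>2 *\<^sub>R b"
      using B by (auto simp: right_singular_basis_def)
    then have "b \<noteq> 0 \<and> b \<in> eigenspace (transpose X ** X) ((norm (X *v b))\<^sup>2)"
      by (auto simp: eigenspace_def)
    then show "norm (X *v b) \<in> singular_values X"
      unfolding singular_values_def by (intro CollectI conjI norm_ge_zero exI [of _ b]) auto
  qed
  then have "(\<Sum>b\<in>B. norm (X *v b)) =
      (\<Sum>s\<in>singular_values X. \<Sum>b\<in>{b\<in>B. norm (X *v b) = s}. norm (X *v b))"
    using B by (intro sum.group [symmetric] finite_singular_values)
      (auto simp: right_singular_basis_def)
  also have "\<dots> = nuclear_norm X"
    unfolding nuclear_norm_def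
    by (intro sum.cong refl) (simp add: sv_multiplicity_eq_card [OF B] singular_values_def)
  finally show ?thesis by simp
qed

text \<open>A matrix that vanishes on a spanning set is zero, so some summand over the basis is
  positive.\<close>

lemma nuclear_norm_pos:
  assumes "X \<noteq> 0"
  shows "0 < nuclear_norm X"
proof -
  obtain B where B: "right_singular_basis X B"
    using right_singular_basis_exists by blast
  have "\<exists>b\<in>B. X *v b \<noteq> 0"
  proof (rule ccontr)
    assume "\<not> (\<exists>b\<in>B. X *v b \<noteq> 0)"
    then have "X *v x = 0 *v x" for x
      using linear_eq_0_on_span [OF matrix_vector_mul_linear, of B X x] B
      by (auto simp: right_singular_basis_def)
    then show False
      using assms by (metis matrix_eq)
  qed
  then show ?thesis
    using B by (auto simp: nuclear_norm_eq_sum [OF B] right_singular_basis_def intro: sum_pos2)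
qed

subsection \<open>Duality of the operator norm and the nuclear norm\<close>

lemma frobenius_inner_le_nuclear_norm:
  assumes "op_norm U \<le> \<rho>"
  shows "frobenius_inner X U \<le> \<rho> * nuclear_norm X"
proof -
  obtain B where B: "right_singular_basis X B"
    using right_singular_basis_exists by blast
  have "(X *v b) \<bullet> (U *v b) \<le> \<rho> * norm (X *v b)" if "b \<in> B" for b
  proof -
    have "norm (U *v b) \<le> \<rho>"
      using norm_mult_le_op_norm [of U b] B that assms by (simp add: right_singular_basis_def)
    then have "norm (X *v b) * norm (U *v b) \<le> norm (X *v b) * \<rho>"
      by (intro mult_left_mono) auto
    then show ?thesis
      using norm_cauchy_schwarz [of "X *v b" "U *v b"] by (simp add: mult.commute)
  qed
  moreover have "frobenius_inner X U = (\<Sum>b\<in>B. (X *v b) \<bullet> (U *v b))"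
    using B by (intro frobenius_inner_orthonormal_basis) (auto simp: right_singular_basis_def)
  ultimately show ?thesis
    by (simp add: nuclear_norm_eq_sum [OF B] sum_distrib_left sum_mono)
qed

text \<open>The witness is the partial isometry of the polar decomposition. It sends a basis vector b to
  \<open>sgn (X *v b)\<close>, which is 0 if b lies in the kernel of X.\<close>

lemma nuclear_norm_attained:
  fixes X :: "real^'n^'m"
  shows "\<exists>U. op_norm U \<le> 1 \<and> frobenius_inner X U = nuclear_norm X"
proof -
  obtain B where B: "right_singular_basis X B"
    using right_singular_basis_exists by blast
  then have fin: "finite B" and orth: "pairwise orthogonal B"
    and unit: "\<And>b. b \<in> B \<Longrightarrow> norm b = 1" and span: "span B = UNIV"
    and eig: "\<And>b. b \<in> B \<Longrightarrow> transpose X ** X *v b = (norm (X *v b))\<^sup>2 *\<^sub>R b"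
    by (auto simp: right_singular_basis_def)
  define g where "g x = (\<Sum>b\<in>B. (x \<bullet> b) *\<^sub>R sgn (X *v b))" for x
  have "linear g"
    unfolding g_def
    by (intro linear_compose_sum ballI linearI) (simp_all add: inner_add_left scaleR_left_distrib)
  define U where "U = matrix g"
  have U: "U *v x = g x" for x
    using \<open>linear g\<close> by (simp add: U_def matrix_works linear_matrix_vector_mul_eq)
  have b_dot: "b \<bullet> c = (if b = c then 1 else 0)" if "b \<in> B" "c \<in> B" for b c
    using that orth unit by (auto simp: pairwise_def orthogonal_def norm_eq_1)
  \<comment> \<open>The images stay orthogonal because the Gram matrix only rescales
    \<open>c\<close>.\<close>
  have Xb_dot: "(X *v b) \<bullet> (X *v c) = 0" if "b \<in> B" "c \<in> B" "b \<noteq> c" for b c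
    using that eig b_dot by (simp flip: inner_gram)
  have gb: "g b = sgn (X *v b)" if "b \<in> B" for b
  proof -
    have "g b = (\<Sum>c\<in>B. if b = c then sgn (X *v c) else 0)"
      unfolding g_def by (intro sum.cong) (auto simp: b_dot that)
    then show ?thesis using that fin by simp
  qed
  \<comment> \<open>The vectors \<open>sgn (X *v b)\<close> are orthogonal of norm at most 1, so
    Pythagoras on the left meets Parseval on the right.\<close>
  have "norm (g x) \<le> norm x" for x
  proof (rule power2_le_imp_le)
    have "(norm (g x))\<^sup>2 = (\<Sum>b\<in>B. (norm ((x \<bullet> b) *\<^sub>R sgn (X *v b)))\<^sup>2)"
      unfolding g_def using fin Xb_dot
      by (intro norm_sum_Pythagorean) (auto simp: pairwise_def orthogonal_def sgn_div_norm)
    also have "\<dots> \<le> (\<Sum>b\<in>B. (x \<bullet> b)\<^sup>2)"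
      by (intro sum_mono) (simp add: norm_sgn power_mult_distrib)
    also have "\<dots> = (norm x)\<^sup>2"
      using inner_orthonormal_basis [OF fin orth unit span, of x x]
      unfolding power2_norm_eq_inner by (simp add: power2_eq_square)
    finally show "(norm (g x))\<^sup>2 \<le> (norm x)\<^sup>2" .
  qed simp
  then have "op_norm U \<le> 1"
    unfolding op_norm_def U by (intro onorm_le) simp
  moreover have "frobenius_inner X U = nuclear_norm X"
  proof -
    have "(X *v b) \<bullet> (U *v b) = norm (X *v b)" if "b \<in> B" for b
    proof -
      \<comment> \<open>For \<open>X *v b = 0\<close> both sides are 0, since division by zero
        yields 0.\<close>
      have "(X *v b) \<bullet> sgn (X *v b) = (norm (X *v b))\<^sup>2 / norm (X *v b)"
        unfolding power2_norm_eq_inner by (simp add: sgn_div_norm divide_inverse)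
      then show ?thesis
        using gb [OF that] by (simp add: U power2_eq_square)
    qed
    then have "(\<Sum>b\<in>B. (X *v b) \<bullet> (U *v b)) = nuclear_norm X"
      by (simp add: nuclear_norm_eq_sum [OF B])
    moreover have "frobenius_inner X U = (\<Sum>b\<in>B. (X *v b) \<bullet> (U *v b))"
      using fin orth unit span by (rule frobenius_inner_orthonormal_basis)
    ultimately show ?thesis by simp
  qed
  ultimately show ?thesis by blast
qed

subsection \<open>Positive definite preconditioners\<close>

lemma sym_pos_def_invertible:
  assumes "sym_pos_def P"
  shows "invertible P"
proof -
  have "x = 0" if "P *v x = 0" for x
    using assms that unfolding sym_pos_def_def by (metis inner_zero_right less_irrefl)
  then show ?thesis
    by (simp add: invertible_left_inverse matrix_left_invertible_ker)
qed

lemma matrix_inv_mult: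
  fixes P :: "real^'n^'n"
  assumes "invertible P"
  shows "P ** matrix_inv P = mat 1" "matrix_inv P ** P = mat 1"
  using someI_ex [OF assms [unfolded invertible_def]] by (auto simp: matrix_inv_def)

theorem theorem1:
  fixes M C Q :: "real^'n^'m" and PB :: "real^'m^'m" and PA :: "real^'n^'n"
    and \<rho> :: real and D :: "real \<Rightarrow> real^'n^'m"
  assumes PB: "sym_pos_def PB"
    and PA: "sym_pos_def PA"
    and C: "C = PB ** M ** PA"
    and rho: "0 \<le> \<rho>"
    and Q: "is_arg_max (frobenius_inner C) (\<lambda>U. op_norm U \<le> 1) Q"
    and D: "\<And>r. D r = r *\<^sub>R (PB ** Q ** PA)"
  shows "((SUP X\<in>{X. precond_norm PB PA X \<le> \<rho>}. frobenius_inner M X) = \<rho> * nuclear_norm C) \<and>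
    (is_arg_max (frobenius_inner M) (\<lambda>X. precond_norm PB PA X \<le> \<rho>) (D \<rho>)) \<and>
    (D 1 = PB ** Q ** PA) \<and>
    (frobenius_inner M (D 1) = frobenius_inner C Q) \<and>
    (frobenius_inner C Q = nuclear_norm C) \<and>
    (M \<noteq> 0 \<longrightarrow> 0 < nuclear_norm C) \<and>
    (is_arg_min (frobenius_inner M) (\<lambda>X. precond_norm PB PA X \<le> \<rho>) (- D \<rho>))"
proof -
  let ?B = "matrix_inv PB" and ?A = "matrix_inv PA"
  note invB = matrix_inv_mult [OF sym_pos_def_invertible [OF PB]]
  note invA = matrix_inv_mult [OF sym_pos_def_invertible [OF PA]]
  have cancel: "PB ** (?B ** X ** ?A) ** PA = X" "?B ** (PB ** X ** PA) ** ?A = X"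
    for X :: "real^'n^'m"
    by (metis invA invB matrix_mul_assoc matrix_mul_lid matrix_mul_rid)+
  have inner_M: "frobenius_inner M (PB ** U ** PA) = frobenius_inner C U" for U
    using PA PB by (simp add: frobenius_inner_mult C sym_pos_def_def)
  \<comment> \<open>\<open>Q\<close> is an arbitrary maximizer, so its value is squeezed between
    that of the polar witness and the duality bound.\<close>
  have Q1: "op_norm Q \<le> 1" and CQ: "frobenius_inner C Q = nuclear_norm C"
  proof -
    show "op_norm Q \<le> 1"
      using Q by (simp add: is_arg_max_def)
    then have "frobenius_inner C Q \<le> nuclear_norm C"
      using frobenius_inner_le_nuclear_norm [of Q 1 C] by simp
    then show "frobenius_inner C Q = nuclear_norm C"
      using Q nuclear_norm_attained [of C] by (force simp: is_arg_max_linorder)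
  qed
  have upper: "frobenius_inner M X \<le> \<rho> * nuclear_norm C" if "precond_norm PB PA X \<le> \<rho>" for X
    using frobenius_inner_le_nuclear_norm [of "?B ** X ** ?A" \<rho> C] that
      inner_M [of "?B ** X ** ?A"]
    by (simp add: precond_norm_def cancel)
  have scale: "?B ** (r *\<^sub>R X) ** ?A = r *\<^sub>R (?B ** X ** ?A)" for r and X :: "real^'n^'m"
    by (metis matrix_scalar_ac scalar_matrix_assoc)
  have precond_scale: "precond_norm PB PA (r *\<^sub>R X) = \<bar>r\<bar> * precond_norm PB PA X" for r X
    by (simp add: precond_norm_def scale op_norm_scaleR)
  have "precond_norm PB PA (PB ** Q ** PA) \<le> 1"
    by (simp add: precond_norm_def cancel Q1)
  then have feas: "precond_norm PB PA (D \<rho>) \<le> \<rho>"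
    using rho by (simp add: D precond_scale mult_left_le)
  have val: "frobenius_inner M (D r) = r * nuclear_norm C" for r
    using inner_M [of Q] CQ by (simp add: D frobenius_inner_eq_inner)
  have neg: "precond_norm PB PA (- X) = precond_norm PB PA X" for X
    using precond_scale [of "-1" X] by simp
  \<comment> \<open>The feasible set is symmetric under negation, so the upper bound at
    \<open>- X\<close> gives this one.\<close>
  have lower: "- (\<rho> * nuclear_norm C) \<le> frobenius_inner M X"
    if "precond_norm PB PA X \<le> \<rho>" for X
    using upper [of "- X"] that by (simp add: neg frobenius_inner_eq_inner)
  \<comment> \<open>The bound is attained at \<open>D \<rho>\<close>, so the supremum is a genuine
    maximum and not an unspecified value of \<open>Sup\<close>.\<close>
  have "(SUP X\<in>{X. precond_norm PB PA X \<le> \<rho>}. frobenius_inner M X) = \<rho> * nuclear_norm C"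
    by (rule cSup_eq_maximum) (use feas upper val in \<open>auto simp: image_iff intro!: exI [of _ "D \<rho>"]\<close>)
  moreover have "is_arg_max (frobenius_inner M) (\<lambda>X. precond_norm PB PA X \<le> \<rho>) (D \<rho>)"
    using feas upper val by (simp add: is_arg_max_linorder)
  moreover have "is_arg_min (frobenius_inner M) (\<lambda>X. precond_norm PB PA X \<le> \<rho>) (- D \<rho>)"
    using feas lower val [of \<rho>] by (simp add: is_arg_min_linorder neg frobenius_inner_eq_inner)
  moreover have "0 < nuclear_norm C" if "M \<noteq> 0"
  proof (rule nuclear_norm_pos)
    \<comment> \<open>Invertibility recovers \<open>M\<close> from \<open>C\<close>, so
      \<open>C = 0\<close> would force \<open>M = 0\<close>.\<close>
    have "M = ?B ** C ** ?A"
      by (simp add: C cancel)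
    then show "C \<noteq> 0"
      using that by auto
  qed
  ultimately show ?thesis
    using val [of 1] CQ by (simp add: D)
qed

end
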